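(* Let $(X,\|\cdot\|)$ be a Banach space, let $C\subset X$ be nonempty, closed, bounded and convex, let $p\ge 1$ be real, and let $T:C\to C$ be $((\alpha_1,\alpha_2),p)$-nonexpansive. Then there exist sequences $(x_n)_n$ and $(y_n)_n$ in $C$ such that $$\|T(\alpha_1x_n+\alpha_2y_n)-x_n\|\to 0\quad\text{and}\quad \|T^2(\alpha_1x_n+\alpha_2y_n)-y_n\|\to 0 ,$$ and moreover these sequences satisfy $$\|Tx_n-y_n\|\to 0\quad\text{and}\quad \|T(\alpha_1x_n+\alpha_2Tx_n)-x_n\|\to 0 .$$ In particular, $(x_n)_n$ is an approximate fixed point sequence for $\tau_\alpha:=T\circ(\alpha_1I+\alpha_2T):C\to C$.
   Context: Here $\alpha=(\alpha_1,\alpha_2)$ with $\alpha_1,\alpha_2>0$ and $\alpha_1+\alpha_2=1$. For $p\in[1,\infty)$, a map $T:C\to C$ is $((\alpha_1,\alpha_2),p)$-nonexpansive if $\alpha_1\|Tx-Ty\|^p+\alpha_2\|T^2x-T^2y\|^p\le\|x-y\|^p$ for all $x,y\in C$, where $T^2=T\circ T$. $I$ is the identity map, so $\tau_\alpha(x)=T(\alpha_1x+\alpha_2Tx)$. An approximate fixed point sequence for a map $F:C\to C$ is a sequence $(x_n)_n$ in $C$ with $\|Fx_n-x_n\|\to0$. *)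

theory Defs
  imports "HOL-Analysis.Analysis"
begin

text \<open>
  Self-maps of \<open>C\<close> are total functions on the ambient type that send \<open>C\<close> into \<open>C\<close>;
  their values off \<open>C\<close> are irrelevant.
\<close>

definition mean_nonexpansive ::
  "real \<Rightarrow> real \<Rightarrow> real \<Rightarrow> 'a::real_normed_vector set \<Rightarrow> ('a \<Rightarrow> 'a) \<Rightarrow> bool" where
  "mean_nonexpansive \<alpha>\<^sub>1 \<alpha>\<^sub>2 p C T \<longleftrightarrow>
     (\<forall>x\<in>C. \<forall>y\<in>C. \<alpha>\<^sub>1 * norm (T x - T y) powr p
        + \<alpha>\<^sub>2 * norm ((T ^^ 2) x - (T ^^ 2) y) powr p \<le> norm (x - y) powr p)"

definition tau_map ::
  "real \<Rightarrow> real \<Rightarrow> ('a::real_vector \<Rightarrow> 'a) \<Rightarrow> 'a \<Rightarrow> 'a" where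
  "tau_map \<alpha>\<^sub>1 \<alpha>\<^sub>2 T = T \<circ> (\<lambda>x. \<alpha>\<^sub>1 *\<^sub>R x + \<alpha>\<^sub>2 *\<^sub>R T x)"

definition approx_fixed_point_seq ::
  "'a::real_normed_vector set \<Rightarrow> ('a \<Rightarrow> 'a) \<Rightarrow> (nat \<Rightarrow> 'a) \<Rightarrow> bool" where
  "approx_fixed_point_seq C F x \<longleftrightarrow>
     (\<forall>n. x n \<in> C) \<and> (\<lambda>n. norm (F (x n) - x n)) \<longlonglongrightarrow> 0"

end

theory Submission
  imports Defs
begin

text \<open>
  By the power mean inequality every \<open>(\<alpha>, p)\<close>-nonexpansive map is \<open>(\<alpha>, 1)\<close>-nonexpansive.
  Hence \<open>w \<mapsto> \<alpha>\<^sub>1 T w + \<alpha>\<^sub>2 T\<^sup>2 w\<close> is nonexpansive on \<open>C\<close> and has approximate fixed points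
  \<open>w\<^sub>n\<close>, and \<open>T\<close>, \<open>T\<^sup>2\<close> are Lipschitz on \<open>C\<close>. The sequences \<open>x\<^sub>n = T w\<^sub>n\<close> and \<open>y\<^sub>n = T\<^sup>2 w\<^sub>n\<close> do the job:
  \<open>\<alpha>\<^sub>1 x\<^sub>n + \<alpha>\<^sub>2 y\<^sub>n\<close> is asymptotically \<open>w\<^sub>n\<close>, and \<open>y\<^sub>n = T x\<^sub>n\<close> holds exactly.
\<close>

text \<open>Jensen's inequality for the p-th power. Convexity is invoked only between positive
  points; a zero argument is treated separately.\<close>

lemma powr_convex_combination:
  fixes a b u v p :: real
  assumes "a > 0" "b > 0" "a + b = 1" "p \<ge> 1" "u \<ge> 0" "v \<ge> 0"
  shows "(a * u + b * v) powr p \<le> a * u powr p + b * v powr p"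
proof -
  \<comment> \<open>Covers the case of a vanishing summand: \<open>0 powr p = 0\<close>, and a
    weight in (0,1] can only shrink when raised to a power p \<ge> 1.\<close>
  have scale: "(c * t) powr p \<le> c * t powr p" if "0 < c" "c \<le> 1" "0 \<le> t" for c t :: real
  proof -
    have "c powr p \<le> c powr 1"
      using that assms(4) by (intro powr_mono') auto
    then show ?thesis
      using that by (simp add: powr_mult mult_right_mono)
  qed
  consider "u = 0" | "v = 0" | "u > 0" "v > 0"
    using assms by linarith
  then show ?thesis
  proof cases
    case 1
    then show ?thesis using scale[of b v] assms by simp
  next
    case 2
    then show ?thesis using scale[of a u] assms by simp
  next
    case 3
    have "1 - b = a" using assms by simp
    with 3 assms show ?thesis
      using convex_onD[OF powr_convex[OF assms(4)], of b u v] by simp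
  qed
qed

text \<open>Jensen bounds the p-th power of the weighted mean of \<open>?u\<close> and
  \<open>?v\<close>; strict monotonicity of the p-th power then allows it to be cancelled.\<close>

lemma mean_nonexpansive_imp_one:
  assumes "\<alpha>\<^sub>1 > 0" "\<alpha>\<^sub>2 > 0" "\<alpha>\<^sub>1 + \<alpha>\<^sub>2 = 1" "p \<ge> 1"
    and "mean_nonexpansive \<alpha>\<^sub>1 \<alpha>\<^sub>2 p C T"
  shows "mean_nonexpansive \<alpha>\<^sub>1 \<alpha>\<^sub>2 1 C T"
  unfolding mean_nonexpansive_def
proof (intro ballI)
  fix x y assume "x \<in> C" "y \<in> C"
  let ?u = "norm (T x - T y)" and ?v = "norm ((T ^^ 2) x - (T ^^ 2) y)"
  have "(\<alpha>\<^sub>1 * ?u + \<alpha>\<^sub>2 * ?v) powr p \<le> \<alpha>\<^sub>1 * ?u powr p + \<alpha>\<^sub>2 * ?v powr p"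
    using assms by (intro powr_convex_combination) auto
  also have "\<dots> \<le> norm (x - y) powr p"
    using assms(5) \<open>x \<in> C\<close> \<open>y \<in> C\<close> by (simp add: mean_nonexpansive_def)
  finally have "\<alpha>\<^sub>1 * ?u + \<alpha>\<^sub>2 * ?v \<le> norm (x - y)"
    using powr_less_mono2[of p "norm (x - y)" "\<alpha>\<^sub>1 * ?u + \<alpha>\<^sub>2 * ?v"] assms(4)
    by (meson less_le_trans linorder_not_le norm_ge_zero zero_less_one)
  then show "\<alpha>\<^sub>1 * ?u powr 1 + \<alpha>\<^sub>2 * ?v powr 1 \<le> norm (x - y) powr 1"
    by simp
qed

text \<open>Contractions close to \<open>G\<close> have exact fixed points by Banach's theorem, and
  boundedness of \<open>C\<close> makes the approximation uniform.\<close>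

lemma nonexpansive_has_approx_fixed_point_seq:
  fixes C :: "'a::banach set"
  assumes "C \<noteq> {}" "closed C" "bounded C" "convex C" "G \<in> C \<rightarrow> C"
    and G: "\<And>x y. x \<in> C \<Longrightarrow> y \<in> C \<Longrightarrow> norm (G x - G y) \<le> norm (x - y)"
  obtains w where "approx_fixed_point_seq C G w"
proof -
  obtain z where z: "z \<in> C" using assms(1) by blast
  obtain B where B: "\<And>x. x \<in> C \<Longrightarrow> norm x \<le> B"
    using assms(3) by (auto simp: bounded_iff)
  define t where "t n = inverse (real (Suc n))" for n
  have t: "0 < t n" "t n \<le> 1" for n
    by (auto simp: t_def field_simps)
  \<comment> \<open>Pulling \<open>G\<close> towards \<open>z\<close> with weight \<open>t n\<close>
    stays in \<open>C\<close> by convexity and lowers the Lipschitz constant to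
    \<open>1 - t n\<close>. For n = 0 the map is constant.\<close>
  define F where "F n x = (1 - t n) *\<^sub>R G x + t n *\<^sub>R z" for n x
  have "\<exists>!x\<in>C. F n x = x" for n
  proof (rule Banach_fix)
    show "complete C" using assms(2) by (simp add: complete_eq_closed)
    show "F n ` C \<subseteq> C"
      using t[of n] z assms(4,5) by (auto simp: F_def intro!: convexD)
    fix x y assume "x \<in> C" "y \<in> C"
    have "dist (F n x) (F n y) = norm ((1 - t n) *\<^sub>R (G x - G y))"
      by (simp add: F_def dist_norm scaleR_diff_right)
    also have "\<dots> \<le> (1 - t n) * dist x y"
      using G[OF \<open>x \<in> C\<close> \<open>y \<in> C\<close>] t[of n] by (simp add: dist_norm mult_left_mono)
    finally show "dist (F n x) (F n y) \<le> (1 - t n) * dist x y" .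
  qed (use t[of n] assms(1) in auto)
  then obtain w where w: "\<And>n. w n \<in> C" "\<And>n. F n (w n) = w n"
    by metis
  \<comment> \<open>At a fixed point of \<open>F n\<close> the defect of \<open>G\<close> is exactly
    the pull towards \<open>z\<close>; \<open>B + B\<close> bounds the distance between points of
    \<open>C\<close>.\<close>
  have "norm (G (w n) - w n) \<le> t n * (B + B)" for n
  proof -
    have "G (w n) - w n = G (w n) - F n (w n)"
      by (simp add: w(2))
    also have "\<dots> = t n *\<^sub>R (G (w n) - z)"
      by (simp add: F_def algebra_simps)
    finally have "norm (G (w n) - w n) = t n * norm (G (w n) - z)"
      using t[of n] by simp
    also have "\<dots> \<le> t n * (B + B)"
      using t[of n] w(1)[of n] z assms(5) B
      by (intro mult_left_mono order_trans[OF norm_triangle_ineq4] add_mono) auto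
    finally show ?thesis .
  qed
  moreover have "(\<lambda>n. t n * (B + B)) \<longlonglongrightarrow> 0"
    unfolding t_def by (intro tendsto_mult_left_zero LIMSEQ_inverse_real_of_nat)
  ultimately have "(\<lambda>n. norm (G (w n) - w n)) \<longlonglongrightarrow> 0"
    by (rule_tac Lim_null_comparison) (auto intro: always_eventually)
  with w(1) show ?thesis
    by (intro that[of w]) (simp add: approx_fixed_point_seq_def)
qed

theorem theorem3p2:
  fixes C :: "'a::banach set" and T :: "'a \<Rightarrow> 'a" and \<alpha>\<^sub>1 \<alpha>\<^sub>2 p :: real
  assumes "\<alpha>\<^sub>1 > 0" and "\<alpha>\<^sub>2 > 0" and "\<alpha>\<^sub>1 + \<alpha>\<^sub>2 = 1"
    and "C \<noteq> {}" and "closed C" and "bounded C" and "convex C"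
    and "p \<ge> 1"
    and "T \<in> C \<rightarrow> C"
    and "mean_nonexpansive \<alpha>\<^sub>1 \<alpha>\<^sub>2 p C T"
  shows "tau_map \<alpha>\<^sub>1 \<alpha>\<^sub>2 T \<in> C \<rightarrow> C \<and>
    (\<exists>x y :: nat \<Rightarrow> 'a. (\<forall>n. x n \<in> C) \<and> (\<forall>n. y n \<in> C) \<and>
       (\<lambda>n. norm (T (\<alpha>\<^sub>1 *\<^sub>R x n + \<alpha>\<^sub>2 *\<^sub>R y n) - x n)) \<longlonglongrightarrow> 0 \<and>
       (\<lambda>n. norm ((T ^^ 2) (\<alpha>\<^sub>1 *\<^sub>R x n + \<alpha>\<^sub>2 *\<^sub>R y n) - y n)) \<longlonglongrightarrow> 0 \<and>
       (\<lambda>n. norm (T (x n) - y n)) \<longlonglongrightarrow> 0 \<and>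
       (\<lambda>n. norm (T (\<alpha>\<^sub>1 *\<^sub>R x n + \<alpha>\<^sub>2 *\<^sub>R T (x n)) - x n)) \<longlonglongrightarrow> 0 \<and>
       approx_fixed_point_seq C (tau_map \<alpha>\<^sub>1 \<alpha>\<^sub>2 T) x)"
proof -
  have one: "\<alpha>\<^sub>1 * norm (T x - T y) + \<alpha>\<^sub>2 * norm (T (T x) - T (T y)) \<le> norm (x - y)"
    if "x \<in> C" "y \<in> C" for x y
    using mean_nonexpansive_imp_one[OF assms(1-3,8,10)] that
    by (auto simp: mean_nonexpansive_def numeral_2_eq_2)
  have TC: "T x \<in> C" if "x \<in> C" for x
    using assms(9) that by auto
  have mix: "\<alpha>\<^sub>1 *\<^sub>R x + \<alpha>\<^sub>2 *\<^sub>R y \<in> C" if "x \<in> C" "y \<in> C" for x y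
    using assms(1-3,7) that by (intro convexD) auto
  define G where "G w = \<alpha>\<^sub>1 *\<^sub>R T w + \<alpha>\<^sub>2 *\<^sub>R T (T w)" for w
  have GC: "G \<in> C \<rightarrow> C"
    by (auto simp: G_def intro!: mix TC)
  \<comment> \<open>With exponent 1, the triangle inequality leads to exactly the left side of
    \<open>one\<close>.\<close>
  have G: "norm (G x - G y) \<le> norm (x - y)" if "x \<in> C" "y \<in> C" for x y
  proof -
    have "G x - G y = \<alpha>\<^sub>1 *\<^sub>R (T x - T y) + \<alpha>\<^sub>2 *\<^sub>R (T (T x) - T (T y))"
      by (simp add: G_def algebra_simps)
    also have "norm \<dots> \<le> \<alpha>\<^sub>1 * norm (T x - T y) + \<alpha>\<^sub>2 * norm (T (T x) - T (T y))"
      using assms(1,2) norm_triangle_ineq[of "\<alpha>\<^sub>1 *\<^sub>R (T x - T y)"] by (metis abs_of_pos norm_scaleR)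
    finally show ?thesis using one[OF that] by simp
  qed
  obtain w where "approx_fixed_point_seq C G w"
    using nonexpansive_has_approx_fixed_point_seq[OF assms(4-7) GC G] by blast
  then have w: "w n \<in> C" and lim: "(\<lambda>n. norm (G (w n) - w n)) \<longlonglongrightarrow> 0" for n
    by (auto simp: approx_fixed_point_seq_def)
  have Gw: "G (w n) \<in> C" for n
    using GC w by auto
  \<comment> \<open>Discarding the nonnegative second summand of \<open>one\<close> shows that
    \<open>T\<close> has Lipschitz constant \<open>1 / \<alpha>\<^sub>1\<close> on
    \<open>C\<close>.\<close>
  have "norm (T (G (w n)) - T (w n)) \<le> norm (G (w n) - w n) / \<alpha>\<^sub>1" for n
  proof -
    have "0 \<le> \<alpha>\<^sub>2 * norm (T (T (G (w n))) - T (T (w n)))"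
      using assms(2) by simp
    then have "\<alpha>\<^sub>1 * norm (T (G (w n)) - T (w n)) \<le> norm (G (w n) - w n)"
      using one[OF Gw[of n] w[of n]] by linarith
    then show ?thesis
      using assms(1) by (simp add: pos_le_divide_eq mult.commute)
  qed
  then have lim1: "(\<lambda>n. norm (T (G (w n)) - T (w n))) \<longlonglongrightarrow> 0"
    using tendsto_divide_zero[OF lim]
    by (rule_tac Lim_null_comparison[where g = "\<lambda>n. norm (G (w n) - w n) / \<alpha>\<^sub>1"]) auto
  \<comment> \<open>Symmetrically, discarding the first summand controls the second iterate, with
    constant \<open>1 / \<alpha>\<^sub>2\<close>.\<close>
  have "norm (T (T (G (w n))) - T (T (w n))) \<le> norm (G (w n) - w n) / \<alpha>\<^sub>2" for n
  proof -
    have "0 \<le> \<alpha>\<^sub>1 * norm (T (G (w n)) - T (w n))"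
      using assms(1) by simp
    then have "\<alpha>\<^sub>2 * norm (T (T (G (w n))) - T (T (w n))) \<le> norm (G (w n) - w n)"
      using one[OF Gw[of n] w[of n]] by linarith
    then show ?thesis
      using assms(2) by (simp add: pos_le_divide_eq mult.commute)
  qed
  then have lim2: "(\<lambda>n. norm (T (T (G (w n))) - T (T (w n)))) \<longlonglongrightarrow> 0"
    using tendsto_divide_zero[OF lim]
    by (rule_tac Lim_null_comparison[where g = "\<lambda>n. norm (G (w n) - w n) / \<alpha>\<^sub>2"]) auto
  have "tau_map \<alpha>\<^sub>1 \<alpha>\<^sub>2 T \<in> C \<rightarrow> C"
    by (auto simp: tau_map_def intro!: TC mix)
  \<comment> \<open>For these witnesses the convex combination is \<open>G (w n)\<close>, so
    \<open>lim1\<close> and \<open>lim2\<close> are the first two limits. The third sequence is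
    identically 0, and the last two claims repeat \<open>lim1\<close>.\<close>
  then show ?thesis
    using lim1 lim2 w TC
    by (intro conjI exI[of _ "\<lambda>n. T (w n)"] exI[of _ "\<lambda>n. T (T (w n))"])
      (auto simp: approx_fixed_point_seq_def tau_map_def numeral_2_eq_2 G_def)
qed

end
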